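(* Let $\phi:M_n(\mathbb{C})\to M_n(\mathbb{C})$ be $q$-positive and let $U\in M_n(\mathbb{C})$ be unitary. For any linear map $\beta$ on $M_n(\mathbb{C})$ define $\beta_U(A)=U^*\beta(UAU^* )U$; in particular $\phi_U(A)=U^*\phi(UAU^* )U$. (1) The map $\phi_U$ is $q$-positive, and there is an order isomorphism (with respect to $\ge_q$), $\beta\mapsto\beta_U$, between the $q$-positive maps $\beta$ such that $\phi\ge_q\beta$ and the $q$-positive maps $\beta_U$ such that $\phi_U\ge_q\beta_U$. In particular, $\phi$ is $q$-pure if and only if $\phi_U$ is $q$-pure. (2) If $\phi$ is unital and $q$-pure, then there is a hyper maximal $q$-corner from $\phi$ to $\phi_U$.
   Context: Throughout, $I$ also denotes the identity map. A linear map $\phi:M_n(\mathbb{C})\to M_n(\mathbb{C})$ is $q$-positive (written $\phi\ge_q0$) if it has no negative eigenvalues and $\phi(I+t\phi)^{-1}$ is completely positive for all $t\ge0$. For $q$-positive $\phi,\psi$ on $M_n(\mathbb{C})$, write $\phi\ge_q\psi$ (and call $\psi$ a $q$-subordinate of $\phi$) if $\phi(I+t\phi)^{-1}-\psi(I+t\psi)^{-1}$ is completely positive for all $t\ge0$. For $s\ge0$ let $\phi^{(s)}=\phi(I+s\phi)^{-1}$. A unital $q$-positive map $\phi$ is $q$-pure if its set of $q$-subordinates is precisely $\{0\}\cup\{\phi^{(s)}\}_{s\ge0}$. Let $\phi$ on $M_n(\mathbb{C})$ and $\psi$ on $M_k(\mathbb{C})$ be $q$-positive. For a linear map $\gamma:M_{n\times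 k}(\mathbb{C})\to M_{n\times k}(\mathbb{C})$ let $\gamma^*:M_{k\times n}(\mathbb{C})\to M_{k\times n}(\mathbb{C})$, $\gamma^*(C)=\gamma(C^* )^*$. $\gamma$ is a $q$-corner from $\phi$ to $\psi$ if the map $\Upsilon$ on $M_{n+k}(\mathbb{C})$, $$\Upsilon\begin{pmatrix}A&B\\C&D\end{pmatrix}=\begin{pmatrix}\phi(A)&\gamma(B)\\\gamma^*(C)&\psi(D)\end{pmatrix},$$ is $q$-positive. A $q$-corner $\gamma$ is hyper maximal if, whenever $\Upsilon\ge_q\Upsilon'\ge_q0$ for a map of the form $\Upsilon'=\begin{pmatrix}\phi'&\gamma\\\gamma^*&\psi'\end{pmatrix}$ (same off-diagonal entries), one has $\Upsilon=\Upsilon'$. *)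

theory Defs
  imports "HOL-Analysis.Analysis"
begin

section \<open>Complex matrices\<close>

text \<open>
  The type \<open>complex^'k^'n\<close> is the space of matrices with rows indexed by \<open>'n\<close> and columns
  indexed by \<open>'k\<close>. The \<open>linear\<close> of the real vector space library would only mean
  real-linear, hence the explicit complex scaling.
\<close>

definition mscale :: "complex \<Rightarrow> complex^'k^'n \<Rightarrow> complex^'k^'n" where
  "mscale c A = (\<chi> i j. c * A $ i $ j)"

lemma vector_space_mscale: "vector_space mscale"
  by unfold_locales (simp_all add: mscale_def vec_eq_iff algebra_simps)

lemma mscale_of_real: "mscale (of_real t) A = t *\<^sub>R A"
  by (simp add: mscale_def vec_eq_iff scaleR_conv_of_real[where 'a = complex])

abbreviation clinear :: "(complex^'k^'n \<Rightarrow> complex^'l^'m) \<Rightarrow> bool" where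
  "clinear \<equiv> Vector_Spaces.linear mscale mscale"

definition ctranspose :: "complex^'k^'n \<Rightarrow> complex^'n^'k" where
  "ctranspose A = (\<chi> i j. cnj (A $ j $ i))"

definition unitary :: "complex^'n^'n \<Rightarrow> bool" where
  "unitary U \<longleftrightarrow> ctranspose U ** U = mat 1 \<and> U ** ctranspose U = mat 1"

definition cdot :: "complex^'n \<Rightarrow> complex^'n \<Rightarrow> complex" where
  "cdot x y = (\<Sum>i\<in>UNIV. cnj (x $ i) * y $ i)"


section \<open>Completely positive maps\<close>

text \<open>
  An element of \<open>M\<^sub>m(M\<^sub>n(\<complex>))\<close> is given by its blocks \<open>A i j\<close> for \<open>i, j < m\<close> (values at other
  indices are irrelevant); it is positive if it is positive as an operator on the \<open>m\<close>-fold
  direct sum of \<open>\<complex>\<^sup>n\<close>.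
\<close>

definition block_positive :: "nat \<Rightarrow> (nat \<Rightarrow> nat \<Rightarrow> complex^'n^'n) \<Rightarrow> bool" where
  "block_positive m A \<longleftrightarrow>
     (\<forall>v :: nat \<Rightarrow> complex^'n. (\<Sum>i<m. \<Sum>j<m. cdot (v i) (A i j *v v j)) \<in> \<real>\<^sub>\<ge>\<^sub>0)"

definition completely_positive :: "(complex^'n^'n \<Rightarrow> complex^'n^'n) \<Rightarrow> bool" where
  "completely_positive \<phi> \<longleftrightarrow> clinear \<phi> \<and>
     (\<forall>m A. block_positive m A \<longrightarrow> block_positive m (\<lambda>i j. \<phi> (A i j)))"


section \<open>q-positive and q-pure maps\<close>

definition eigenvalue :: "(complex^'n^'n \<Rightarrow> complex^'n^'n) \<Rightarrow> complex \<Rightarrow> bool" where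
  "eigenvalue \<phi> c \<longleftrightarrow> (\<exists>A. A \<noteq> 0 \<and> \<phi> A = mscale c A)"

text \<open>
  The map \<open>\<phi>\<^sup>(\<^sup>t\<^sup>) = \<phi>(I + t\<phi>)\<^sup>-\<^sup>1\<close>. It is only meaningful where \<open>I + t\<phi>\<close> is bijective; for a
  linear map without negative eigenvalues this is so for all \<open>t \<ge> 0\<close>.
\<close>

definition qtrans ::
    "(complex^'n^'n \<Rightarrow> complex^'n^'n) \<Rightarrow> real \<Rightarrow> complex^'n^'n \<Rightarrow> complex^'n^'n" where
  "qtrans \<phi> t = \<phi> \<circ> inv (\<lambda>A. A + t *\<^sub>R \<phi> A)"

definition q_positive :: "(complex^'n^'n \<Rightarrow> complex^'n^'n) \<Rightarrow> bool" where
  "q_positive \<phi> \<longleftrightarrow> clinear \<phi> \<and> (\<forall>r<0. \<not> eigenvalue \<phi> (complex_of_real r)) \<and>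
     (\<forall>t\<ge>0. completely_positive (qtrans \<phi> t))"

definition q_ge :: "(complex^'n^'n \<Rightarrow> complex^'n^'n) \<Rightarrow>
    (complex^'n^'n \<Rightarrow> complex^'n^'n) \<Rightarrow> bool"  (infix \<open>\<ge>\<^sub>q\<close> 50) where
  "\<phi> \<ge>\<^sub>q \<psi> \<longleftrightarrow> q_positive \<phi> \<and> q_positive \<psi> \<and>
     (\<forall>t\<ge>0. completely_positive (\<lambda>A. qtrans \<phi> t A - qtrans \<psi> t A))"

definition unital :: "(complex^'n^'n \<Rightarrow> complex^'n^'n) \<Rightarrow> bool" where
  "unital \<phi> \<longleftrightarrow> \<phi> (mat 1) = mat 1"

definition q_pure :: "(complex^'n^'n \<Rightarrow> complex^'n^'n) \<Rightarrow> bool" where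
  "q_pure \<phi> \<longleftrightarrow> unital \<phi> \<and> q_positive \<phi> \<and>
     {\<psi>. \<phi> \<ge>\<^sub>q \<psi>} = {\<lambda>_. 0} \<union> {qtrans \<phi> s | s. s \<ge> 0}"


section \<open>q-corners\<close>

text \<open>
  Matrices of size \<open>n + k\<close> are indexed by the sum type \<open>'n + 'k\<close>, which gives the block
  decomposition with \<open>n \<times> n\<close>, \<open>n \<times> k\<close>, \<open>k \<times> n\<close> and \<open>k \<times> k\<close> blocks.
\<close>

definition four_block :: "complex^'n^'n \<Rightarrow> complex^'k^'n \<Rightarrow> complex^'n^'k \<Rightarrow> complex^'k^'k \<Rightarrow>
    complex^('n + 'k)^('n + 'k)" where
  "four_block A B C D = (\<chi> i j.
     case i of
       Inl a \<Rightarrow> (case j of Inl b \<Rightarrow> A $ a $ b | Inr b \<Rightarrow> B $ a $ b)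
     | Inr a \<Rightarrow> (case j of Inl b \<Rightarrow> C $ a $ b | Inr b \<Rightarrow> D $ a $ b))"

definition star_map ::
    "(complex^'k^'n \<Rightarrow> complex^'k^'n) \<Rightarrow> complex^'n^'k \<Rightarrow> complex^'n^'k" where
  "star_map \<gamma> C = ctranspose (\<gamma> (ctranspose C))"

definition block_map :: "(complex^'n^'n \<Rightarrow> complex^'n^'n) \<Rightarrow> (complex^'k^'n \<Rightarrow> complex^'k^'n) \<Rightarrow>
    (complex^'k^'k \<Rightarrow> complex^'k^'k) \<Rightarrow>
    complex^('n + 'k)^('n + 'k) \<Rightarrow> complex^('n + 'k)^('n + 'k)" where
  "block_map \<phi> \<gamma> \<psi> M = four_block
     (\<phi> (\<chi> i j. M $ Inl i $ Inl j)) (\<gamma> (\<chi> i j. M $ Inl i $ Inr j))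
     (star_map \<gamma> (\<chi> i j. M $ Inr i $ Inl j)) (\<psi> (\<chi> i j. M $ Inr i $ Inr j))"

lemma block_map_four_block:
  "block_map \<phi> \<gamma> \<psi> (four_block A B C D) = four_block (\<phi> A) (\<gamma> B) (star_map \<gamma> C) (\<psi> D)"
  by (simp add: block_map_def four_block_def)

definition q_corner :: "(complex^'n^'n \<Rightarrow> complex^'n^'n) \<Rightarrow> (complex^'k^'k \<Rightarrow> complex^'k^'k) \<Rightarrow>
    (complex^'k^'n \<Rightarrow> complex^'k^'n) \<Rightarrow> bool" where
  "q_corner \<phi> \<psi> \<gamma> \<longleftrightarrow> q_positive \<phi> \<and> q_positive \<psi> \<and> clinear \<gamma> \<and>
     q_positive (block_map \<phi> \<gamma> \<psi>)"

definition hyper_maximal_q_corner :: "(complex^'n^'n \<Rightarrow> complex^'n^'n) \<Rightarrow>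
    (complex^'k^'k \<Rightarrow> complex^'k^'k) \<Rightarrow> (complex^'k^'n \<Rightarrow> complex^'k^'n) \<Rightarrow> bool" where
  "hyper_maximal_q_corner \<phi> \<psi> \<gamma> \<longleftrightarrow> q_corner \<phi> \<psi> \<gamma> \<and>
     (\<forall>\<phi>' \<psi>'. block_map \<phi> \<gamma> \<psi> \<ge>\<^sub>q block_map \<phi>' \<gamma> \<psi>' \<longrightarrow>
        block_map \<phi> \<gamma> \<psi> = block_map \<phi>' \<gamma> \<psi>')"


section \<open>Conjugation by a unitary\<close>

definition conj_map :: "complex^'n^'n \<Rightarrow> (complex^'n^'n \<Rightarrow> complex^'n^'n) \<Rightarrow>
    complex^'n^'n \<Rightarrow> complex^'n^'n" where
  "conj_map U \<beta> A = ctranspose U ** \<beta> (U ** A ** ctranspose U) ** U"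

end

theory Submission
  imports Defs
begin

text \<open>
  Everything rests on how \<open>q\<close>-positivity behaves under compression. For a rectangular matrix \<open>V\<close>
  with \<open>V\<^sup>*V = 1\<close>, consider \<open>A \<mapsto> V\<^sup>* \<Theta>(V A V\<^sup>*) V\<close>. If \<open>\<Theta>\<close> maps the subspace \<open>V M\<^sub>n V\<^sup>*\<close> into
  itself, this compression is a copy of the restriction of \<open>\<Theta>\<close>, so it inherits the absence of
  negative eigenvalues, and taking \<open>\<Theta>\<^sup>(\<^sup>t\<^sup>)\<close> commutes with compressing (\<open>qtrans_compress\<close>). As
  compressions preserve complete positivity, they preserve \<open>q\<close>-positivity and the order \<open>\<ge>\<^sub>q\<close>.

  Conjugation by a unitary is the case of a square \<open>V\<close>, where the subspace is everything; being
  invertible, with the conjugation by \<open>U\<^sup>*\<close> as its inverse, it is an order isomorphism on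
  subordinates, and it commutes with the operation \<open>\<phi> \<mapsto> \<phi>\<^sup>(\<^sup>s\<^sup>)\<close> that describes them in the
  \<open>q\<close>-pure case.

  For the corner, start from \<open>U = 1\<close> and \<open>\<gamma> = \<phi>\<close>. The block map is then the amplification
  \<open>\<phi> \<otimes> id\<close> on two-by-two matrices over \<open>M\<^sub>n\<close>, which is \<open>q\<close>-positive because complete positivity
  is stable under amplification and because the eigenvalue and resolvent equations decouple into
  the four blocks (\<open>q_positive_amplification\<close>). Suppose it dominates a map with the same
  off-diagonal entries and with diagonal \<open>(\<phi>', \<psi>')\<close>. Compressing to the corners shows that \<open>\<phi>'\<close>
  and \<open>\<psi>'\<close> are subordinates of the unital \<open>q\<close>-pure map \<open>\<phi>\<close>, so each of them is \<open>0\<close> or some \<open>\<phi>\<^sup>(\<^sup>s\<^sup>)\<close>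
  and sends \<open>1\<close> to \<open>a\<cdot>1\<close> and \<open>d\<cdot>1\<close> respectively, with \<open>a, d \<le> 1\<close> and equality only for \<open>\<phi>\<close>
  itself. Positivity of the image of the matrix with four blocks \<open>1\<close> forces \<open>a + d \<ge> 2\<close>, whence
  \<open>\<phi>' = \<psi>' = \<phi>\<close> (\<open>amplification_subordinate_eq\<close>).

  Finally, conjugation by the unitary \<open>1 \<oplus> U\<close> turns the amplification into the block map with
  diagonal \<open>(\<phi>, \<phi>\<^sub>U)\<close> and corner \<open>\<gamma>(B) = \<phi>(B U\<^sup>*) U\<close> and preserves \<open>\<ge>\<^sub>q\<close>, so this corner is hyper
  maximal as well.
\<close>

section \<open>Matrix algebra\<close>

lemma clinear_iff:
  "clinear f \<longleftrightarrow> (\<forall>A B. f (A + B) = f A + f B) \<and> (\<forall>c A. f (mscale c A) = mscale c (f A))"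
  by (simp add: Vector_Spaces.linear_iff vector_space_mscale)

lemma clinear_scaleR:
  assumes "clinear f"
  shows "f (t *\<^sub>R A) = t *\<^sub>R f A"
proof -
  have "f (mscale (complex_of_real t) A) = mscale (complex_of_real t) (f A)"
    using assms unfolding clinear_iff by blast
  then show ?thesis
    by (simp only: mscale_of_real)
qed

lemma clinear_imp_linear:
  assumes "clinear f"
  shows "linear f"
proof (rule linearI)
  show "f (A + B) = f A + f B" for A B
    using assms unfolding clinear_iff by blast
  show "f (t *\<^sub>R A) = t *\<^sub>R f A" for t A
    by (rule clinear_scaleR[OF assms])
qed

lemma mscale_mult_left: "mscale c A ** B = mscale c (A ** B)"
  by (simp add: mscale_def matrix_matrix_mult_def vec_eq_iff sum_distrib_left mult.assoc)

lemma mscale_mult_right: "A ** mscale c B = mscale c (A ** B)"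
  by (simp add: mscale_def matrix_matrix_mult_def vec_eq_iff sum_distrib_left mult.left_commute)

lemma ctranspose_mult: "ctranspose (A ** B) = ctranspose B ** ctranspose A"
  by (simp add: ctranspose_def matrix_matrix_mult_def vec_eq_iff mult.commute)

lemma ctranspose_ctranspose [simp]: "ctranspose (ctranspose A) = A"
  by (simp add: ctranspose_def vec_eq_iff)

lemma ctranspose_mat_1 [simp]: "ctranspose (mat 1) = mat 1"
  by (simp add: ctranspose_def mat_def vec_eq_iff)

lemma ctranspose_zero [simp]: "ctranspose 0 = 0"
  by (simp add: ctranspose_def vec_eq_iff)

lemma matrix_mult_zero [simp]: "(A :: complex^'m^'n) ** 0 = 0" "0 ** (B :: complex^'m^'n) = 0"
  by (simp_all add: matrix_matrix_mult_def vec_eq_iff)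

lemma matrix_add_rdistrib: "((A :: complex^'m^'n) + B) ** C = A ** C + B ** C"
  by (simp add: matrix_matrix_mult_def vec_eq_iff sum.distrib distrib_right)

lemma matrix_diff_distrib:
  fixes A B :: "complex^'m^'n"
  shows "X ** (A - B) = X ** A - X ** B" and "(A - B) ** Y = A ** Y - B ** Y"
  by (simp_all add: matrix_matrix_mult_def vec_eq_iff sum_subtractf algebra_simps)

lemma matrix_vector_mult_minus: "(A :: complex^'m^'n) *v (- x) = - (A *v x)"
  by (simp add: matrix_vector_mult_def vec_eq_iff sum_negf)

lemma cdot_mult_left: "cdot (X *v x) y = cdot x (ctranspose X *v y)"
proof -
  have "cdot (X *v x) y = (\<Sum>i\<in>UNIV. \<Sum>j\<in>UNIV. cnj (X $ i $ j) * cnj (x $ j) * y $ i)"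
    by (simp add: cdot_def matrix_vector_mult_def sum_distrib_right)
  also have "\<dots> = (\<Sum>j\<in>UNIV. \<Sum>i\<in>UNIV. cnj (X $ i $ j) * cnj (x $ j) * y $ i)"
    by (rule sum.swap)
  finally show ?thesis
    by (simp add: cdot_def matrix_vector_mult_def ctranspose_def sum_distrib_left mult_ac)
qed

lemma cdot_simps:
  "cdot x (y + z) = cdot x y + cdot x z"
  "cdot (y + z) x = cdot y x + cdot z x"
  "cdot x (- y) = - cdot x y"
  "cdot (- x) y = - cdot x y"
  "cdot x 0 = 0"
  "cdot 0 x = 0"
  by (simp_all add: cdot_def distrib_left distrib_right sum.distrib sum_negf)

lemma cdot_self: "cdot x x \<in> \<real>\<^sub>\<ge>\<^sub>0"
proof -
  have "cdot x x = complex_of_real (\<Sum>i\<in>UNIV. (norm (x $ i))\<^sup>2)"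
    by (simp add: cdot_def complex_norm_square mult.commute del: of_real_power)
  then show ?thesis
    by (simp add: sum_nonneg del: of_real_sum)
qed

lemma cdot_axis: "cdot (axis i a) (M *v axis j b) = cnj a * (M $ i $ j) * b"
  by (simp add: cdot_def matrix_vector_mult_def axis_def if_distrib if_distribR cong: if_cong)

section \<open>Positivity and complete positivity\<close>

lemma block_positive_congruence:
  assumes "block_positive m A"
  shows "block_positive m (\<lambda>i j. X ** A i j ** ctranspose X)"
proof -
  have "cdot v ((X ** B ** ctranspose X) *v w) = cdot (ctranspose X *v v) (B *v (ctranspose X *v w))"
    for v w B
    by (simp add: cdot_mult_left matrix_vector_mul_assoc[symmetric])
  then show ?thesis
    using assms by (simp add: block_positive_def)
qed

text \<open>Polarisation: a quadratic form with real values comes from a Hermitian operator. The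
  vectors \<open>e\<^sub>a\<close> and \<open>c e\<^sub>b\<close> are placed in the two slots, with \<open>c = 1\<close> and \<open>c = \<i>\<close>.\<close>

lemma block_positive_hermitian:
  fixes A :: "nat \<Rightarrow> nat \<Rightarrow> complex^'n^'n"
  assumes "block_positive 2 A"
  shows "A 0 1 = ctranspose (A 1 0)"
proof -
  have real: "Im (cdot x (A 0 0 *v x) + cdot x (A 0 1 *v y) + cdot y (A 1 0 *v x)
      + cdot y (A 1 1 *v y)) = 0" for x y
  proof -
    show ?thesis
      using assms[unfolded block_positive_def, rule_format, of "\<lambda>i. if i = 0 then x else y"]
      by (simp add: numeral_2_eq_2 complex_nonneg_Reals_iff algebra_simps)
  qed
  have off: "Im (cdot x (A 0 1 *v y) + cdot y (A 1 0 *v x)) = 0" for x y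
    using real[of x y] real[of x 0] real[of 0 y] by (simp add: cdot_simps)
  have "A 0 1 $ a $ b = cnj (A 1 0 $ b $ a)" for a b
    using off[of "axis a 1" "axis b 1"] off[of "axis a 1" "axis b \<i>"]
    by (simp add: cdot_axis complex_eq_iff)
  then show ?thesis
    by (simp add: ctranspose_def vec_eq_iff)
qed

text \<open>The block matrix with rows \<open>(X\<^sup>*X, X\<^sup>*)\<close> and \<open>(X, 1)\<close> is positive, being of the form
  \<open>R\<^sup>*R\<close> for the row \<open>R = (X, 1)\<close>. Its image is positive, hence Hermitian, and has the
  off-diagonal entries \<open>\<phi>(X\<^sup>*)\<close> and \<open>\<phi>(X)\<close>.\<close>

lemma completely_positive_ctranspose:
  fixes \<phi> :: "complex^'n^'n \<Rightarrow> complex^'n^'n"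
  assumes "completely_positive \<phi>"
  shows "\<phi> (ctranspose X) = ctranspose (\<phi> X)"
proof -
  define Y where "Y = (\<lambda>i::nat. if i = 0 then X else mat 1)"
  define A where "A = (\<lambda>i j. ctranspose (Y i) ** Y j)"
  have "block_positive 2 A"
    unfolding block_positive_def
  proof
    fix v :: "nat \<Rightarrow> complex^'n"
    have gram: "cdot x ((ctranspose B ** C) *v y) = cdot (B *v x) (C *v y)"
      for x y :: "complex^'n" and B C :: "complex^'n^'n"
      by (simp add: cdot_mult_left matrix_vector_mul_assoc[symmetric])
    have "(\<Sum>i<2. \<Sum>j<2. cdot (v i) (A i j *v v j))
        = cdot (Y 0 *v v 0 + Y 1 *v v 1) (Y 0 *v v 0 + Y 1 *v v 1)"
      by (simp add: A_def gram numeral_2_eq_2 cdot_simps)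
    then show "(\<Sum>i<2. \<Sum>j<2. cdot (v i) (A i j *v v j)) \<in> \<real>\<^sub>\<ge>\<^sub>0"
      by (simp only: cdot_self)
  qed
  then have "block_positive 2 (\<lambda>i j. \<phi> (A i j))"
    using assms by (simp add: completely_positive_def)
  from block_positive_hermitian[OF this] show ?thesis
    by (simp add: A_def Y_def)
qed

lemma completely_positive_star_map: "completely_positive \<phi> \<Longrightarrow> star_map \<phi> = \<phi>"
  by (simp add: star_map_def fun_eq_iff completely_positive_ctranspose)

section \<open>The resolvents of a q-positive map\<close>

text \<open>A nonzero kernel vector of \<open>I + t\<phi>\<close> would be an eigenvector for \<open>-1/t\<close>; injectivity suffices
  in finite dimension.\<close>

lemma no_negative_eigenvalue_imp_bij:
  fixes \<phi> :: "complex^'n^'n \<Rightarrow> complex^'n^'n"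
  assumes lin: "clinear \<phi>" and ev: "\<forall>r<0. \<not> eigenvalue \<phi> (complex_of_real r)" and "t \<ge> 0"
  shows "bij (\<lambda>A. A + t *\<^sub>R \<phi> A)"
proof -
  let ?f = "\<lambda>A. A + t *\<^sub>R \<phi> A"
  have linf: "linear ?f"
    using clinear_imp_linear[OF lin]
    by (intro linearI) (simp_all add: linear_add linear_scale algebra_simps)
  have "A = 0" if "?f A = 0" for A
  proof (cases "t = 0")
    case False
    from that have "t *\<^sub>R \<phi> A = - A"
      by (simp add: eq_neg_iff_add_eq_0 add.commute)
    then have "(1 / t) *\<^sub>R (t *\<^sub>R \<phi> A) = (1 / t) *\<^sub>R (- A)"
      by simp
    then have "\<phi> A = mscale (complex_of_real (- 1 / t)) A"
      using False unfolding mscale_of_real by simp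
    then show ?thesis
      using ev[rule_format, of "- 1 / t"] \<open>t \<ge> 0\<close> False by (auto simp: eigenvalue_def)
  qed (use that in simp)
  then have "inj ?f"
    using linear_injective_0[OF linf] by blast
  then show ?thesis
    using linear_injective_imp_surjective[OF linf] by (simp add: bij_def)
qed

lemma q_positive_bij: "q_positive \<phi> \<Longrightarrow> t \<ge> 0 \<Longrightarrow> bij (\<lambda>A. A + t *\<^sub>R \<phi> A)"
  by (simp add: q_positive_def no_negative_eigenvalue_imp_bij)

lemma qtrans_apply:
  assumes "bij (\<lambda>A. A + t *\<^sub>R \<phi> A)"
  shows "qtrans \<phi> t (A + t *\<^sub>R \<phi> A) = \<phi> A"
  using inv_f_f[OF bij_is_inj[OF assms], of A] by (simp add: qtrans_def)

lemma qtrans_0: "qtrans \<phi> 0 = \<phi>"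
proof -
  have "inv (\<lambda>A :: complex^'n^'n. A) = (\<lambda>A. A)"
    using inv_id by (simp add: id_def)
  then show ?thesis
    by (simp add: qtrans_def fun_eq_iff)
qed

lemma q_positive_imp_completely_positive: "q_positive \<phi> \<Longrightarrow> completely_positive \<phi>"
  unfolding q_positive_def by (metis order_refl qtrans_0)

section \<open>Compressions\<close>

text \<open>A rectangular matrix \<open>V\<close> is allowed so that one construction covers both conjugation by a
  unitary and the passage from a map on \<open>M\<^sub>n\<^sub>+\<^sub>k\<close> to a diagonal corner of it.\<close>

definition compress ::
  "complex^'n^'m \<Rightarrow> (complex^'m^'m \<Rightarrow> complex^'m^'m) \<Rightarrow> complex^'n^'n \<Rightarrow> complex^'n^'n" where
  "compress V \<Theta> A = ctranspose V ** \<Theta> (V ** A ** ctranspose V) ** V"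

lemma conj_map_eq_compress: "conj_map U = compress U"
  by (simp add: fun_eq_iff conj_map_def compress_def)

lemma clinear_compress:
  assumes "clinear \<Theta>"
  shows "clinear (compress V \<Theta>)"
  using assms
  by (simp add: clinear_iff compress_def matrix_add_ldistrib matrix_add_rdistrib
      mscale_mult_left mscale_mult_right)

lemma completely_positive_compress:
  fixes V :: "complex^'n^'m"
  assumes "completely_positive \<Theta>"
  shows "completely_positive (compress V \<Theta>)"
  unfolding completely_positive_def
proof (intro conjI allI impI)
  show "clinear (compress V \<Theta>)"
    using assms by (simp add: completely_positive_def clinear_compress)
  fix m and A :: "nat \<Rightarrow> nat \<Rightarrow> complex^'n^'n"
  assume "block_positive m A"
  then have "block_positive m (\<lambda>i j. \<Theta> (V ** A i j ** ctranspose V))"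
    using assms block_positive_congruence[of m A V] by (simp add: completely_positive_def)
  from block_positive_congruence[OF this, of "ctranspose V"]
  show "block_positive m (\<lambda>i j. compress V \<Theta> (A i j))"
    by (simp add: compress_def)
qed

text \<open>The equation for \<open>\<Theta>\<close> says that \<open>\<Theta>\<close> leaves the subspace \<open>V M\<^sub>n V\<^sup>*\<close> invariant.\<close>

definition reduces :: "complex^'n^'m \<Rightarrow> (complex^'m^'m \<Rightarrow> complex^'m^'m) \<Rightarrow> bool" where
  "reduces V \<Theta> \<longleftrightarrow> ctranspose V ** V = mat 1 \<and>
     (\<forall>A. \<Theta> (V ** A ** ctranspose V) = V ** compress V \<Theta> A ** ctranspose V)"

lemma compress_cancel:
  assumes "ctranspose V ** V = mat 1"
  shows "ctranspose V ** (V ** A ** ctranspose V) ** V = A"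
proof -
  have "ctranspose V ** (V ** A ** ctranspose V) ** V
      = (ctranspose V ** V) ** A ** (ctranspose V ** V)"
    by (simp add: matrix_mul_assoc)
  then show ?thesis
    by (simp add: assms)
qed

text \<open>On the invariant subspace \<open>V M\<^sub>n V\<^sup>*\<close>, which \<open>A \<mapsto> V A V\<^sup>*\<close> identifies with \<open>M\<^sub>n\<close>, the map \<open>\<Theta>\<close>
  acts as its compression. Eigenvectors of the compression therefore are eigenvectors of \<open>\<Theta>\<close>,
  and the resolvent of \<open>\<Theta>\<close> restricts to that of the compression.\<close>

lemma compress_no_negative_eigenvalue:
  assumes "q_positive \<Theta>" and "reduces V \<Theta>"
  shows "\<forall>r<0. \<not> eigenvalue (compress V \<Theta>) (complex_of_real r)"
proof (intro allI impI notI)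
  fix r :: real assume "r < 0" and "eigenvalue (compress V \<Theta>) (complex_of_real r)"
  then obtain A where "A \<noteq> 0" and A: "compress V \<Theta> A = mscale (complex_of_real r) A"
    by (auto simp: eigenvalue_def)
  let ?X = "V ** A ** ctranspose V"
  have "\<Theta> ?X = mscale (complex_of_real r) ?X"
    using assms(2) A by (simp add: reduces_def mscale_mult_left mscale_mult_right)
  moreover have "?X \<noteq> 0"
    using compress_cancel[of V A] assms(2) \<open>A \<noteq> 0\<close> by (auto simp: reduces_def)
  ultimately have "eigenvalue \<Theta> (complex_of_real r)"
    by (auto simp: eigenvalue_def)
  then show False
    using assms(1) \<open>r < 0\<close> by (auto simp: q_positive_def)
qed

lemma qtrans_compress:
  assumes "q_positive \<Theta>" and "reduces V \<Theta>" and "t \<ge> 0"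
  shows "qtrans (compress V \<Theta>) t = compress V (qtrans \<Theta> t)"
proof
  fix A
  let ?\<Lambda> = "compress V \<Theta>"
  have bij: "bij (\<lambda>A. A + t *\<^sub>R ?\<Lambda> A)"
    using assms compress_no_negative_eigenvalue
    by (intro no_negative_eigenvalue_imp_bij clinear_compress) (auto simp: q_positive_def)
  obtain B where B: "A = B + t *\<^sub>R ?\<Lambda> B"
    using surjD[OF bij_is_surj[OF bij], of A] by blast
  let ?X = "V ** B ** ctranspose V"
  have "V ** A ** ctranspose V = ?X + t *\<^sub>R \<Theta> ?X"
    using assms(2) unfolding B reduces_def
    by (simp add: matrix_add_ldistrib matrix_add_rdistrib mscale_of_real[symmetric]
        mscale_mult_left mscale_mult_right)
  then have "compress V (qtrans \<Theta> t) A = ?\<Lambda> B"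
    using qtrans_apply[OF q_positive_bij[OF assms(1,3)]] by (simp add: compress_def)
  then show "qtrans ?\<Lambda> t A = compress V (qtrans \<Theta> t) A"
    using qtrans_apply[OF bij] B by simp
qed

lemma q_positive_compress:
  assumes "q_positive \<Theta>" and "reduces V \<Theta>"
  shows "q_positive (compress V \<Theta>)"
  using assms compress_no_negative_eigenvalue[OF assms]
  by (auto simp: q_positive_def qtrans_compress clinear_compress completely_positive_compress)

lemma q_ge_compress:
  assumes "\<Theta> \<ge>\<^sub>q \<Theta>'" and "reduces V \<Theta>" and "reduces V \<Theta>'"
  shows "compress V \<Theta> \<ge>\<^sub>q compress V \<Theta>'"
proof -
  have "completely_positive (\<lambda>A. compress V (qtrans \<Theta> t) A - compress V (qtrans \<Theta>' t) A)"
    if "t \<ge> 0" for t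
  proof -
    have "completely_positive (compress V (\<lambda>A. qtrans \<Theta> t A - qtrans \<Theta>' t A))"
      using assms(1) that by (simp add: q_ge_def completely_positive_compress)
    moreover have "compress V (\<lambda>A. qtrans \<Theta> t A - qtrans \<Theta>' t A)
        = (\<lambda>A. compress V (qtrans \<Theta> t) A - compress V (qtrans \<Theta>' t) A)"
      by (simp add: fun_eq_iff compress_def matrix_diff_distrib)
    ultimately show ?thesis
      by simp
  qed
  then show ?thesis
    using assms by (simp add: q_ge_def q_positive_compress qtrans_compress)
qed

section \<open>Conjugation by a unitary\<close>

lemma unitary_ctranspose: "unitary U \<Longrightarrow> unitary (ctranspose U)"
  by (simp add: unitary_def)

lemma unitary_reduces:
  assumes "unitary U"
  shows "reduces U \<Theta>"
  using assms compress_cancel[of "ctranspose U"] by (simp add: reduces_def compress_def unitary_def)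

lemma conj_map_inverse:
  assumes "unitary U"
  shows "conj_map (ctranspose U) (conj_map U \<beta>) = \<beta>"
  using assms compress_cancel[of "ctranspose U"] by (simp add: fun_eq_iff conj_map_def unitary_def)

lemma conj_map_inverse':
  "unitary U \<Longrightarrow> conj_map U (conj_map (ctranspose U) \<beta>) = \<beta>"
  using conj_map_inverse[of "ctranspose U"] by (simp add: unitary_ctranspose)

lemma q_positive_conj_map: "unitary U \<Longrightarrow> q_positive \<phi> \<Longrightarrow> q_positive (conj_map U \<phi>)"
  by (simp add: conj_map_eq_compress q_positive_compress unitary_reduces)

lemma qtrans_conj_map:
  "unitary U \<Longrightarrow> q_positive \<phi> \<Longrightarrow> t \<ge> 0 \<Longrightarrow> qtrans (conj_map U \<phi>) t = conj_map U (qtrans \<phi> t)"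
  by (simp add: conj_map_eq_compress qtrans_compress unitary_reduces)

lemma q_ge_conj_map_iff:
  assumes "unitary U"
  shows "conj_map U \<phi> \<ge>\<^sub>q conj_map U \<psi> \<longleftrightarrow> \<phi> \<ge>\<^sub>q \<psi>"
proof
  have mono: "conj_map V \<alpha> \<ge>\<^sub>q conj_map V \<beta>" if "unitary V" "\<alpha> \<ge>\<^sub>q \<beta>"
    for V :: "complex^'a^'a" and \<alpha> \<beta>
    using that by (simp add: conj_map_eq_compress q_ge_compress unitary_reduces)
  show "conj_map U \<phi> \<ge>\<^sub>q conj_map U \<psi>" if "\<phi> \<ge>\<^sub>q \<psi>"
    by (rule mono[OF assms that])
  show "\<phi> \<ge>\<^sub>q \<psi>" if "conj_map U \<phi> \<ge>\<^sub>q conj_map U \<psi>"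
    using mono[OF unitary_ctranspose[OF assms] that] by (simp add: conj_map_inverse assms)
qed

lemma bij_betw_conj_map_subordinates:
  assumes "unitary U"
  shows "bij_betw (conj_map U) {\<beta>. \<phi> \<ge>\<^sub>q \<beta>} {\<beta>. conj_map U \<phi> \<ge>\<^sub>q \<beta>}"
proof (rule bij_betw_byWitness[where f' = "conj_map (ctranspose U)"])
  have "\<phi> \<ge>\<^sub>q conj_map (ctranspose U) \<beta>" if "conj_map U \<phi> \<ge>\<^sub>q \<beta>" for \<beta>
    using that q_ge_conj_map_iff[OF assms, of \<phi> "conj_map (ctranspose U) \<beta>"]
    by (simp add: conj_map_inverse' assms)
  then show "conj_map (ctranspose U) ` {\<beta>. conj_map U \<phi> \<ge>\<^sub>q \<beta>} \<subseteq> {\<beta>. \<phi> \<ge>\<^sub>q \<beta>}"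
    by auto
qed (auto simp: assms conj_map_inverse conj_map_inverse' q_ge_conj_map_iff)

lemma q_pure_conj_map:
  assumes "unitary U" and pure: "q_pure \<phi>"
  shows "q_pure (conj_map U \<phi>)"
proof -
  have "unital (conj_map U \<phi>)"
    using assms by (simp add: unital_def conj_map_def unitary_def q_pure_def)
  moreover have "{\<beta>. conj_map U \<phi> \<ge>\<^sub>q \<beta>} = {\<lambda>_. 0} \<union> {qtrans (conj_map U \<phi>) s | s. s \<ge> 0}"
  proof -
    have zero: "conj_map U (\<lambda>_. 0) = (\<lambda>_. 0)"
      by (simp add: conj_map_def fun_eq_iff)
    have "{\<beta>. conj_map U \<phi> \<ge>\<^sub>q \<beta>} = conj_map U ` {\<beta>. \<phi> \<ge>\<^sub>q \<beta>}"
      using bij_betw_conj_map_subordinates[OF assms(1)] by (simp add: bij_betw_def)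
    also have "\<dots> = conj_map U ` ({\<lambda>_. 0} \<union> {qtrans \<phi> s | s. s \<ge> 0})"
      using pure by (simp add: q_pure_def)
    also have "\<dots> = {\<lambda>_. 0} \<union> {conj_map U (qtrans \<phi> s) | s. s \<ge> 0}"
      by (auto simp: zero)
    also have "{conj_map U (qtrans \<phi> s) | s. s \<ge> 0} = {qtrans (conj_map U \<phi>) s | s. s \<ge> 0}"
      using qtrans_conj_map[OF assms(1)] pure by (metis q_pure_def)
    finally show ?thesis .
  qed
  ultimately show ?thesis
    using assms by (simp add: q_pure_def q_positive_conj_map)
qed

section \<open>Block matrices\<close>

lemma four_block_exhaust:
  obtains A B C D where "M = four_block A B C D"
proof
  show "M = four_block (\<chi> i j. M $ Inl i $ Inl j) (\<chi> i j. M $ Inl i $ Inr j)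
      (\<chi> i j. M $ Inr i $ Inl j) (\<chi> i j. M $ Inr i $ Inr j)"
    by (simp add: four_block_def vec_eq_iff split: sum.split)
qed

lemma four_block_eq_iff:
  "four_block A B C D = four_block A' B' C' D' \<longleftrightarrow> A = A' \<and> B = B' \<and> C = C' \<and> D = D'"
proof
  assume eq: "four_block A B C D = four_block A' B' C' D'"
  have "four_block A B C D $ i $ j = four_block A' B' C' D' $ i $ j" for i j
    by (simp add: eq)
  from this[of "Inl _" "Inl _"] this[of "Inl _" "Inr _"] this[of "Inr _" "Inl _"]
    this[of "Inr _" "Inr _"]
  show "A = A' \<and> B = B' \<and> C = C' \<and> D = D'"
    by (simp add: four_block_def vec_eq_iff)
qed simp

lemma four_block_add:
  "four_block A B C D + four_block A' B' C' D' = four_block (A + A') (B + B') (C + C') (D + D')"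
  by (simp add: four_block_def vec_eq_iff split: sum.split)

lemma mscale_four_block:
  "mscale c (four_block A B C D) = four_block (mscale c A) (mscale c B) (mscale c C) (mscale c D)"
  by (simp add: four_block_def mscale_def vec_eq_iff split: sum.split)

lemma four_block_zero: "four_block 0 0 0 0 = 0"
  by (simp add: four_block_def vec_eq_iff split: sum.split)

lemma four_block_one: "four_block (mat 1) 0 0 (mat 1) = mat 1"
  by (simp add: four_block_def mat_def vec_eq_iff split: sum.split)

lemma ctranspose_four_block:
  "ctranspose (four_block A B C D)
    = four_block (ctranspose A) (ctranspose C) (ctranspose B) (ctranspose D)"
  by (simp add: four_block_def ctranspose_def vec_eq_iff split: sum.split)

lemma sum_UNIV_sum:
  fixes f :: "'a::finite + 'b::finite \<Rightarrow> 'c::comm_monoid_add"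
  shows "(\<Sum>x\<in>UNIV. f x) = (\<Sum>a\<in>UNIV. f (Inl a)) + (\<Sum>b\<in>UNIV. f (Inr b))"
  by (subst UNIV_Plus_UNIV[symmetric], subst sum.Plus) simp_all

lemma four_block_mult:
  "four_block A B C D ** four_block A' B' C' D'
    = four_block (A ** A' + B ** C') (A ** B' + B ** D') (C ** A' + D ** C') (C ** B' + D ** D')"
  by (simp add: four_block_def matrix_matrix_mult_def vec_eq_iff sum_UNIV_sum split: sum.split)

definition two_block :: "complex^'n \<Rightarrow> complex^'k \<Rightarrow> complex^('n + 'k)" where
  "two_block x y = (\<chi> i. case i of Inl a \<Rightarrow> x $ a | Inr b \<Rightarrow> y $ b)"

lemma two_block_exhaust:
  obtains x y where "v = two_block x y"
proof
  show "v = two_block (\<chi> a. v $ Inl a) (\<chi> b. v $ Inr b)"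
    by (simp add: two_block_def vec_eq_iff split: sum.split)
qed

lemma cdot_four_block:
  "cdot (two_block x y) (four_block A B C D *v two_block x' y')
    = cdot x (A *v x') + cdot x (B *v y') + cdot y (C *v x') + cdot y (D *v y')"
  by (simp add: cdot_def two_block_def four_block_def matrix_vector_mult_def sum_UNIV_sum
      distrib_left sum.distrib)

text \<open>The two inclusions of \<open>\<complex>\<^sup>n\<close> and \<open>\<complex>\<^sup>k\<close> into \<open>\<complex>\<^sup>n\<^sup>+\<^sup>k\<close>.\<close>

definition incl_left :: "complex^'n^('n + 'k::finite)" where
  "incl_left = (\<chi> i j. case i of Inl a \<Rightarrow> if a = j then 1 else 0 | Inr _ \<Rightarrow> 0)"

definition incl_right :: "complex^'k^('n::finite + 'k)" where
  "incl_right = (\<chi> i j. case i of Inl _ \<Rightarrow> 0 | Inr b \<Rightarrow> if b = j then 1 else 0)"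

lemma incl_embed:
  "incl_left ** A ** ctranspose incl_left = four_block A 0 0 0"
  "incl_right ** D ** ctranspose incl_right = four_block 0 0 0 D"
  by (simp_all add: incl_left_def incl_right_def ctranspose_def four_block_def
      matrix_matrix_mult_def vec_eq_iff if_distrib if_distribR cong: if_cong split: sum.split)

lemma incl_corner:
  "ctranspose incl_left ** four_block A B C D ** incl_left = A"
  "ctranspose incl_right ** four_block A B C D ** incl_right = D"
  by (simp_all add: incl_left_def incl_right_def ctranspose_def four_block_def sum_UNIV_sum
      matrix_matrix_mult_def vec_eq_iff if_distrib if_distribR cong: if_cong)

lemma incl_isometry:
  "ctranspose (incl_left :: complex^'n^('n + 'k::finite)) ** incl_left = mat 1"
  "ctranspose (incl_right :: complex^'k^('n::finite + 'k)) ** incl_right = mat 1"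
  using incl_corner[of "mat 1 :: complex^'n^'n" 0 0 "mat 1 :: complex^'k^'k"]
  by (simp_all add: four_block_one)

lemma clinear_zero: "clinear \<gamma> \<Longrightarrow> \<gamma> 0 = 0"
  by (rule linear_0[OF clinear_imp_linear])

lemma compress_block_map:
  "compress incl_left (block_map \<phi> \<gamma> \<psi>) = \<phi>"
  "compress incl_right (block_map \<phi> \<gamma> \<psi>) = \<psi>"
  by (simp_all add: fun_eq_iff compress_def incl_embed incl_corner block_map_four_block)

lemma reduces_incl:
  fixes \<phi> :: "complex^'n^'n \<Rightarrow> complex^'n^'n" and \<psi> :: "complex^'k^'k \<Rightarrow> complex^'k^'k"
  assumes "clinear \<gamma>"
  shows "\<psi> 0 = 0 \<Longrightarrow> reduces incl_left (block_map \<phi> \<gamma> \<psi>)"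
    and "\<phi> 0 = 0 \<Longrightarrow> reduces incl_right (block_map \<phi> \<gamma> \<psi>)"
  using clinear_zero[OF assms]
  by (simp_all add: reduces_def incl_isometry compress_block_map incl_embed block_map_four_block
      star_map_def)

lemma clinear_block_map_diagonal_zero:
  assumes "clinear (block_map \<phi> \<gamma> \<psi>)"
  shows "\<phi> 0 = 0" and "\<psi> 0 = 0"
proof -
  have "block_map \<phi> \<gamma> \<psi> (four_block 0 0 0 0) = four_block 0 0 0 0"
    using clinear_zero[OF assms] by (simp add: four_block_zero)
  then show "\<phi> 0 = 0" and "\<psi> 0 = 0"
    by (simp_all add: block_map_four_block four_block_eq_iff)
qed

text \<open>Block maps leave each diagonal corner invariant, so both relations are compressions of the
  given one.\<close>

lemma q_ge_block_map_diagonal: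
  assumes ge: "block_map \<phi> \<gamma> \<psi> \<ge>\<^sub>q block_map \<phi>' \<gamma> \<psi>'" and \<gamma>: "clinear \<gamma>"
  shows "\<phi> \<ge>\<^sub>q \<phi>'" and "\<psi> \<ge>\<^sub>q \<psi>'"
proof -
  have lin: "clinear (block_map \<phi> \<gamma> \<psi>)" "clinear (block_map \<phi>' \<gamma> \<psi>')"
    using ge by (auto simp: q_ge_def q_positive_def)
  note zero = lin[THEN clinear_block_map_diagonal_zero(1)] lin[THEN clinear_block_map_diagonal_zero(2)]
  show "\<phi> \<ge>\<^sub>q \<phi>'"
    using q_ge_compress[OF ge reduces_incl(1)[OF \<gamma>] reduces_incl(1)[OF \<gamma>]] zero
    by (simp add: compress_block_map)
  show "\<psi> \<ge>\<^sub>q \<psi>'"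
    using q_ge_compress[OF ge reduces_incl(2)[OF \<gamma>] reduces_incl(2)[OF \<gamma>]] zero
    by (simp add: compress_block_map)
qed

section \<open>Amplification by two-by-two matrices\<close>

text \<open>The lower left entry of a block map is the adjoint \<open>\<phi>\<^sup>*\<close> of the corner, so it agrees with \<open>\<phi>\<close> only
  when \<open>\<phi>\<close> preserves adjoints.\<close>

lemma clinear_amplification:
  assumes "clinear \<phi>" and "star_map \<phi> = \<phi>"
  shows "clinear (block_map \<phi> \<phi> \<phi>)"
  unfolding clinear_iff
proof (intro conjI allI)
  fix M N :: "complex^('a + 'a)^('a + 'a)" and c
  obtain A B C D where M: "M = four_block A B C D"
    by (rule four_block_exhaust)
  obtain A' B' C' D' where N: "N = four_block A' B' C' D'"
    by (rule four_block_exhaust)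
  show "block_map \<phi> \<phi> \<phi> (M + N) = block_map \<phi> \<phi> \<phi> M + block_map \<phi> \<phi> \<phi> N"
    using assms(1) unfolding M N
    by (simp add: block_map_four_block assms(2) four_block_add clinear_iff)
  show "block_map \<phi> \<phi> \<phi> (mscale c M) = mscale c (block_map \<phi> \<phi> \<phi> M)"
    using assms(1) unfolding M
    by (simp add: block_map_four_block assms(2) mscale_four_block clinear_iff)
qed

text \<open>The identification of \<open>M\<^sub>m(M\<^sub>2(M\<^sub>n))\<close> with \<open>M\<^sub>2\<^sub>m(M\<^sub>n)\<close>: indices below \<open>m\<close> stand for the first
  block row or column of each two-by-two entry, the others for the second one.\<close>

definition flatten :: "nat \<Rightarrow> (nat \<Rightarrow> nat \<Rightarrow> 'a) \<Rightarrow> (nat \<Rightarrow> nat \<Rightarrow> 'a) \<Rightarrow> (nat \<Rightarrow> nat \<Rightarrow> 'a) \<Rightarrow>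
    (nat \<Rightarrow> nat \<Rightarrow> 'a) \<Rightarrow> nat \<Rightarrow> nat \<Rightarrow> 'a" where
  "flatten m P Q R S p q =
     (if p < m then if q < m then P p q else Q p (q - m)
      else if q < m then R (p - m) q else S (p - m) (q - m))"

lemma sum_lessThan_add:
  fixes f :: "nat \<Rightarrow> 'a::comm_monoid_add"
  shows "(\<Sum>p<m + k. f p) = (\<Sum>i<m. f i) + (\<Sum>i<k. f (m + i))"
  by (induction k) (simp_all add: add.assoc)

lemma quadratic_form_flatten:
  fixes w :: "nat \<Rightarrow> complex^'n"
  shows "(\<Sum>p<m + m. \<Sum>q<m + m. cdot (w p) (flatten m P Q R S p q *v w q)) =
    (\<Sum>i<m. \<Sum>j<m. cdot (two_block (w i) (w (m + i)))
       (four_block (P i j) (Q i j) (R i j) (S i j) *v two_block (w j) (w (m + j))))"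
  by (simp add: sum_lessThan_add flatten_def cdot_four_block sum.distrib add_ac)

lemma block_positive_flatten:
  fixes P :: "nat \<Rightarrow> nat \<Rightarrow> complex^'n^'n"
  shows "block_positive (m + m) (flatten m P Q R S) \<longleftrightarrow>
    block_positive m (\<lambda>i j. four_block (P i j) (Q i j) (R i j) (S i j))"
proof
  assume pos: "block_positive (m + m) (flatten m P Q R S)"
  show "block_positive m (\<lambda>i j. four_block (P i j) (Q i j) (R i j) (S i j))"
    unfolding block_positive_def
  proof
    fix v :: "nat \<Rightarrow> complex^('n + 'n)"
    define w where "w p = (if p < m then (\<chi> a. v p $ Inl a) else (\<chi> a. v (p - m) $ Inr a))" for p
    have v: "v i = two_block (w i) (w (m + i))" if "i < m" for i
      using that by (simp add: w_def two_block_def vec_eq_iff split: sum.split)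
    have "(\<Sum>p<m + m. \<Sum>q<m + m. cdot (w p) (flatten m P Q R S p q *v w q)) \<in> \<real>\<^sub>\<ge>\<^sub>0"
      using pos unfolding block_positive_def by blast
    then show "(\<Sum>i<m. \<Sum>j<m. cdot (v i)
        (four_block (P i j) (Q i j) (R i j) (S i j) *v v j)) \<in> \<real>\<^sub>\<ge>\<^sub>0"
      unfolding quadratic_form_flatten by (simp add: v)
  qed
next
  assume pos: "block_positive m (\<lambda>i j. four_block (P i j) (Q i j) (R i j) (S i j))"
  show "block_positive (m + m) (flatten m P Q R S)"
    unfolding block_positive_def quadratic_form_flatten
  proof
    fix w :: "nat \<Rightarrow> complex^'n"
    show "(\<Sum>i<m. \<Sum>j<m. cdot (two_block (w i) (w (m + i)))
       (four_block (P i j) (Q i j) (R i j) (S i j) *v two_block (w j) (w (m + j)))) \<in> \<real>\<^sub>\<ge>\<^sub>0"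
      using pos[unfolded block_positive_def, rule_format, of "\<lambda>i. two_block (w i) (w (m + i))"] .
  qed
qed

text \<open>Flattening turns a positive element of \<open>M\<^sub>m(M\<^sub>2(M\<^sub>n))\<close> into one of \<open>M\<^sub>2\<^sub>m(M\<^sub>n)\<close>, to which complete
  positivity of \<open>\<phi>\<close> applies at level \<open>2m\<close>.\<close>

lemma completely_positive_amplification:
  fixes \<phi> :: "complex^'n^'n \<Rightarrow> complex^'n^'n"
  assumes cp: "completely_positive \<phi>"
  shows "completely_positive (block_map \<phi> \<phi> \<phi>)"
  unfolding completely_positive_def
proof (intro conjI allI impI)
  note star = completely_positive_star_map[OF cp]
  show "clinear (block_map \<phi> \<phi> \<phi>)"
    using cp star by (simp add: completely_positive_def clinear_amplification)
  fix m and A :: "nat \<Rightarrow> nat \<Rightarrow> complex^('n + 'n)^('n + 'n)"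
  assume pos: "block_positive m A"
  define P where "P i j = (\<chi> a b. A i j $ Inl a $ Inl b)" for i j
  define Q where "Q i j = (\<chi> a b. A i j $ Inl a $ Inr b)" for i j
  define R where "R i j = (\<chi> a b. A i j $ Inr a $ Inl b)" for i j
  define S where "S i j = (\<chi> a b. A i j $ Inr a $ Inr b)" for i j
  have A: "A = (\<lambda>i j. four_block (P i j) (Q i j) (R i j) (S i j))"
    by (simp add: fun_eq_iff P_def Q_def R_def S_def four_block_def vec_eq_iff split: sum.split)
  have "block_positive (m + m) (\<lambda>p q. \<phi> (flatten m P Q R S p q))"
    using cp pos unfolding A completely_positive_def block_positive_flatten[symmetric] by blast
  moreover have "(\<lambda>p q. \<phi> (flatten m P Q R S p q))
      = flatten m (\<lambda>i j. \<phi> (P i j)) (\<lambda>i j. \<phi> (Q i j)) (\<lambda>i j. \<phi> (R i j)) (\<lambda>i j. \<phi> (S i j))"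
    by (simp add: fun_eq_iff flatten_def)
  ultimately show "block_positive m (\<lambda>i j. block_map \<phi> \<phi> \<phi> (A i j))"
    by (simp add: A block_map_four_block star block_positive_flatten)
qed

lemma q_positive_amplification:
  fixes \<phi> :: "complex^'n^'n \<Rightarrow> complex^'n^'n"
  assumes q: "q_positive \<phi>"
  shows "q_positive (block_map \<phi> \<phi> \<phi>)"
proof -
  let ?\<Phi> = "block_map \<phi> \<phi> \<phi>"
  note star = completely_positive_star_map[OF q_positive_imp_completely_positive[OF q]]
  have lin: "clinear ?\<Phi>"
    using q star by (simp add: q_positive_def clinear_amplification)
  have ev: "\<forall>r<0. \<not> eigenvalue ?\<Phi> (complex_of_real r)"
  proof (intro allI impI notI)
    fix r :: real assume "r < 0" and "eigenvalue ?\<Phi> (complex_of_real r)"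
    then obtain M where "M \<noteq> 0" and M: "?\<Phi> M = mscale (complex_of_real r) M"
      by (auto simp: eigenvalue_def)
    obtain A B C D where M_eq: "M = four_block A B C D"
      by (rule four_block_exhaust)
    have "X = 0" if "\<phi> X = mscale (complex_of_real r) X" for X
      using that q \<open>r < 0\<close> by (auto simp: q_positive_def eigenvalue_def)
    then have "A = 0 \<and> B = 0 \<and> C = 0 \<and> D = 0"
      using M by (simp add: M_eq block_map_four_block star mscale_four_block four_block_eq_iff)
    then show False
      using \<open>M \<noteq> 0\<close> by (simp add: M_eq four_block_zero)
  qed
  have "qtrans ?\<Phi> t = block_map (qtrans \<phi> t) (qtrans \<phi> t) (qtrans \<phi> t)" if "t \<ge> 0" for t
  proof
    fix M
    have star_t: "star_map (qtrans \<phi> t) = qtrans \<phi> t"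
      using q that by (simp add: q_positive_def completely_positive_star_map)
    note bij = q_positive_bij[OF q that]
    note bij_\<Phi> = no_negative_eigenvalue_imp_bij[OF lin ev that]
    obtain N where N: "M = N + t *\<^sub>R ?\<Phi> N"
      using surjD[OF bij_is_surj[OF bij_\<Phi>], of M] by blast
    obtain A B C D where N_eq: "N = four_block A B C D"
      by (rule four_block_exhaust)
    have "M = four_block (A + t *\<^sub>R \<phi> A) (B + t *\<^sub>R \<phi> B) (C + t *\<^sub>R \<phi> C) (D + t *\<^sub>R \<phi> D)"
      unfolding N N_eq by (simp add: block_map_four_block star four_block_add mscale_four_block
          mscale_of_real[symmetric])
    then have "block_map (qtrans \<phi> t) (qtrans \<phi> t) (qtrans \<phi> t) M = ?\<Phi> N"
      by (simp add: N_eq block_map_four_block star star_t qtrans_apply[OF bij])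
    also have "\<dots> = qtrans ?\<Phi> t M"
      unfolding N by (rule qtrans_apply[symmetric, OF bij_\<Phi>])
    finally show "qtrans ?\<Phi> t M = block_map (qtrans \<phi> t) (qtrans \<phi> t) (qtrans \<phi> t) M"
      by simp
  qed
  then show ?thesis
    using q lin ev by (auto simp: q_positive_def completely_positive_amplification)
qed

section \<open>The hyper maximal corner\<close>

text \<open>For unital \<open>\<phi>\<close> the map \<open>\<phi>\<^sup>(\<^sup>s\<^sup>)\<close> sends \<open>1\<close> to \<open>1/(1 + s)\<close>. Purity leaves only these maps and \<open>0\<close>
  as subordinates, so the value at \<open>1\<close> detects \<open>\<phi>\<close> among them.\<close>

lemma q_pure_subordinate_one:
  fixes \<phi> :: "complex^'n^'n \<Rightarrow> complex^'n^'n"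
  assumes pure: "q_pure \<phi>" and ge: "\<phi> \<ge>\<^sub>q \<psi>"
  obtains a where "\<psi> (mat 1) = a *\<^sub>R mat 1" and "a \<le> 1" and "a = 1 \<longrightarrow> \<psi> = \<phi>"
proof -
  have "\<psi> \<in> {\<lambda>_. 0} \<union> {qtrans \<phi> s | s. s \<ge> 0}"
    using pure ge by (auto simp: q_pure_def)
  then consider "\<psi> = (\<lambda>_. 0)" | s where "s \<ge> 0" "\<psi> = qtrans \<phi> s"
    by blast
  then show thesis
  proof cases
    case 1
    then show thesis
      using that[of 0] by simp
  next
    case 2
    have q: "q_positive \<phi>" and one: "\<phi> (mat 1) = mat 1"
      using pure by (auto simp: q_pure_def unital_def)
    \<comment> \<open>the preimage of the unit under \<open>I + s\<phi>\<close>\<close>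
    let ?X = "(1 / (1 + s)) *\<^sub>R (mat 1 :: complex^'n^'n)"
    have \<phi>X: "\<phi> ?X = ?X"
      using q one by (simp add: q_positive_def clinear_scaleR)
    have "1 / (1 + s) + s * (1 / (1 + s)) = 1"
      using 2 by (simp add: field_simps)
    then have "?X + s *\<^sub>R \<phi> ?X = mat 1"
      by (simp only: \<phi>X scaleR_scaleR scaleR_left_distrib[symmetric] scaleR_one)
    then have "\<psi> (mat 1) = ?X"
      using qtrans_apply[OF q_positive_bij[OF q \<open>s \<ge> 0\<close>], of ?X] \<phi>X 2 by simp
    moreover have "1 / (1 + s) \<le> 1" and "1 / (1 + s) = 1 \<longrightarrow> \<psi> = \<phi>"
      using 2 by (auto simp: qtrans_0)
    ultimately show thesis
      by (rule that)
  qed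
qed

text \<open>The matrix with all four blocks equal to \<open>1\<close> is positive, so its image, with diagonal
  \<open>(a, d)\<close> and off-diagonal entries \<open>1\<close>, is positive. Its quadratic form at \<open>(x, -x)\<close> is
  \<open>(a + d - 2) \<parallel>x\<parallel>\<^sup>2\<close>.\<close>

lemma completely_positive_block_map_one:
  fixes \<gamma> :: "complex^'n^'n \<Rightarrow> complex^'n^'n"
  assumes cp: "completely_positive (block_map \<phi> \<gamma> \<psi>)" and "\<gamma> (mat 1) = mat 1"
    and "\<phi> (mat 1) = a *\<^sub>R mat 1" and "\<psi> (mat 1) = d *\<^sub>R mat 1"
  shows "a + d \<ge> 2"
proof -
  let ?one = "mat 1 :: complex^'n^'n"
  have "block_positive 1 (\<lambda>i j. four_block ?one ?one ?one ?one)"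
    unfolding block_positive_def
  proof
    fix v :: "nat \<Rightarrow> complex^('n + 'n)"
    obtain x y where "v 0 = two_block x y"
      by (rule two_block_exhaust)
    then show "(\<Sum>i<1. \<Sum>j<1. cdot (v i) (four_block ?one ?one ?one ?one *v v j)) \<in> \<real>\<^sub>\<ge>\<^sub>0"
      using cdot_self[of "x + y"] by (simp add: cdot_four_block cdot_simps add_ac)
  qed
  then have "block_positive 1 (\<lambda>i j. block_map \<phi> \<gamma> \<psi> (four_block ?one ?one ?one ?one))"
    using cp unfolding completely_positive_def by blast
  then have pos: "block_positive 1 (\<lambda>i j. four_block (a *\<^sub>R ?one) ?one ?one (d *\<^sub>R ?one))"
    by (simp only: block_map_four_block assms(2-4) star_map_def ctranspose_mat_1)
  define x :: "complex^'n" where "x = axis undefined 1"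
  have scal: "cdot x (c *\<^sub>R ?one *v x) = complex_of_real c" for c
    by (simp add: x_def cdot_axis mat_def scaleR_conv_of_real[where 'a = complex])
  have norm_x: "cdot x x = 1"
    using scal[of 1] by simp
  have "(\<Sum>i<1::nat. \<Sum>j<1::nat. cdot (two_block x (- x))
      (four_block (a *\<^sub>R ?one) ?one ?one (d *\<^sub>R ?one) *v two_block x (- x))) \<in> \<real>\<^sub>\<ge>\<^sub>0"
    using pos unfolding block_positive_def by fast
  then have "complex_of_real (a + d - 2) \<in> \<real>\<^sub>\<ge>\<^sub>0"
    by (simp add: cdot_four_block cdot_simps scal norm_x matrix_vector_mult_minus algebra_simps)
  then show ?thesis
    by (simp del: of_real_add of_real_diff)
qed

lemma amplification_subordinate_eq:
  assumes pure: "q_pure \<phi>" and ge: "block_map \<phi> \<phi> \<phi> \<ge>\<^sub>q block_map \<phi>' \<phi> \<psi>'"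
  shows "\<phi>' = \<phi>" and "\<psi>' = \<phi>"
proof -
  have lin: "clinear \<phi>" and one: "\<phi> (mat 1) = mat 1"
    using pure by (auto simp: q_pure_def q_positive_def unital_def)
  obtain a where a: "\<phi>' (mat 1) = a *\<^sub>R mat 1" "a \<le> 1" "a = 1 \<longrightarrow> \<phi>' = \<phi>"
    by (rule q_pure_subordinate_one[OF pure q_ge_block_map_diagonal(1)[OF ge lin]])
  obtain d where d: "\<psi>' (mat 1) = d *\<^sub>R mat 1" "d \<le> 1" "d = 1 \<longrightarrow> \<psi>' = \<phi>"
    by (rule q_pure_subordinate_one[OF pure q_ge_block_map_diagonal(2)[OF ge lin]])
  have "completely_positive (block_map \<phi>' \<phi> \<psi>')"
    using ge by (simp add: q_ge_def q_positive_imp_completely_positive)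
  from completely_positive_block_map_one[OF this one a(1) d(1)]
  have "a = 1" and "d = 1"
    using a(2) d(2) by linarith+
  with a d show "\<phi>' = \<phi>" and "\<psi>' = \<phi>"
    by simp_all
qed

definition diag_one :: "complex^'k^'k \<Rightarrow> complex^('n + 'k)^('n::finite + 'k)" where
  "diag_one U = four_block (mat 1) 0 0 U"

lemma unitary_diag_one: "unitary U \<Longrightarrow> unitary (diag_one U)"
  by (simp add: unitary_def diag_one_def ctranspose_four_block four_block_mult four_block_one)

text \<open>Conjugation by \<open>1 \<oplus> U\<close> acts on each block separately: by right multiplication with \<open>U\<close> and
  its inverse on the upper right block, by conjugation with \<open>U\<close> on the lower right one.\<close>

lemma conj_map_diag_one:
  fixes \<phi> :: "complex^'n^'n \<Rightarrow> complex^'n^'n" and \<psi> :: "complex^'k^'k \<Rightarrow> complex^'k^'k"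
  shows "conj_map (diag_one U) (block_map \<phi> \<gamma> \<psi>)
    = block_map \<phi> (\<lambda>B. \<gamma> (B ** ctranspose U) ** U) (conj_map U \<psi>)"
proof
  fix M :: "complex^('n + 'k)^('n + 'k)"
  obtain A B C D where "M = four_block A B C D"
    by (rule four_block_exhaust)
  then show "conj_map (diag_one U) (block_map \<phi> \<gamma> \<psi>) M
    = block_map \<phi> (\<lambda>B. \<gamma> (B ** ctranspose U) ** U) (conj_map U \<psi>) M"
    by (simp add: conj_map_def diag_one_def ctranspose_four_block four_block_mult
        block_map_four_block star_map_def ctranspose_mult)
qed

text \<open>Undoing the conjugation by \<open>1 \<oplus> U\<close> leaves the corner \<open>\<phi>\<close> of the amplification in both block
  maps, so the case \<open>U = 1\<close> applies.\<close>

lemma hyper_maximal_q_corner_conj_map: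
  fixes \<phi> :: "complex^'n^'n \<Rightarrow> complex^'n^'n"
  assumes pure: "q_pure \<phi>" and U: "unitary U"
  shows "hyper_maximal_q_corner \<phi> (conj_map U \<phi>) (\<lambda>B. \<phi> (B ** ctranspose U) ** U)"
proof -
  let ?\<gamma> = "\<lambda>B. \<phi> (B ** ctranspose U) ** U"
  let ?W = "diag_one U :: complex^('n + 'n)^('n + 'n)"
  have q: "q_positive \<phi>"
    using pure by (simp add: q_pure_def)
  have W: "unitary ?W"
    by (rule unitary_diag_one[OF U])
  have \<Upsilon>: "block_map \<phi> ?\<gamma> (conj_map U \<phi>) = conj_map ?W (block_map \<phi> \<phi> \<phi>)"
    by (simp only: conj_map_diag_one)
  have "clinear ?\<gamma>"
    using q by (simp add: q_positive_def clinear_iff matrix_add_rdistrib mscale_mult_left)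
  then have "q_corner \<phi> (conj_map U \<phi>) ?\<gamma>"
    using q by (simp add: q_corner_def q_positive_conj_map U \<Upsilon> W q_positive_amplification)
  moreover have "block_map \<phi> ?\<gamma> (conj_map U \<phi>) = block_map \<phi>' ?\<gamma> \<psi>'"
    if ge: "block_map \<phi> ?\<gamma> (conj_map U \<phi>) \<ge>\<^sub>q block_map \<phi>' ?\<gamma> \<psi>'" for \<phi>' \<psi>'
  proof -
    define \<psi>'' where "\<psi>'' = conj_map (ctranspose U) \<psi>'"
    have \<psi>': "\<psi>' = conj_map U \<psi>''"
      by (simp add: \<psi>''_def conj_map_inverse' U)
    have \<Upsilon>': "block_map \<phi>' ?\<gamma> \<psi>' = conj_map ?W (block_map \<phi>' \<phi> \<psi>'')"
      by (simp only: conj_map_diag_one \<psi>')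
    have "block_map \<phi> \<phi> \<phi> \<ge>\<^sub>q block_map \<phi>' \<phi> \<psi>''"
      using ge unfolding \<Upsilon> \<Upsilon>' by (simp only: q_ge_conj_map_iff[OF W])
    then show ?thesis
      using amplification_subordinate_eq[OF pure] \<psi>' by metis
  qed
  ultimately show ?thesis
    by (simp add: hyper_maximal_q_corner_def)
qed

theorem proposition4p5:
  fixes \<phi> :: "complex^'n^'n \<Rightarrow> complex^'n^'n"
    and U :: "complex^'n^'n"
  assumes "q_positive \<phi>"
    and "unitary U"
  shows "(q_positive (conj_map U \<phi>) \<and>
      bij_betw (conj_map U) {\<beta>. \<phi> \<ge>\<^sub>q \<beta>} {\<beta>. conj_map U \<phi> \<ge>\<^sub>q \<beta>} \<and>
      (\<forall>\<beta>\<^sub>1 \<beta>\<^sub>2. \<phi> \<ge>\<^sub>q \<beta>\<^sub>1 \<longrightarrow> \<phi> \<ge>\<^sub>q \<beta>\<^sub>2 \<longrightarrow>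
        (\<beta>\<^sub>1 \<ge>\<^sub>q \<beta>\<^sub>2 \<longleftrightarrow> conj_map U \<beta>\<^sub>1 \<ge>\<^sub>q conj_map U \<beta>\<^sub>2)) \<and>
      (q_pure \<phi> \<longleftrightarrow> q_pure (conj_map U \<phi>))) \<and>
    (unital \<phi> \<and> q_pure \<phi> \<longrightarrow>
      (\<exists>\<gamma> :: complex^'n^'n \<Rightarrow> complex^'n^'n. hyper_maximal_q_corner \<phi> (conj_map U \<phi>) \<gamma>))"
proof -
  have "q_pure \<phi> \<longleftrightarrow> q_pure (conj_map U \<phi>)"
    using q_pure_conj_map[OF assms(2)] q_pure_conj_map[OF unitary_ctranspose[OF assms(2)]]
    by (metis conj_map_inverse[OF assms(2)])
  then show ?thesis
    using assms q_positive_conj_map bij_betw_conj_map_subordinates q_ge_conj_map_iff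
      hyper_maximal_q_corner_conj_map by blast
qed

end
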